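(* Let $k$ be a field, $A$ a commutative $k$-algebra, and let $(\mathbb{A},\phi_{i,j},\longleftarrow,\leq)$ be a standard monomial theory with straightening relations for $A$ on the multiset $\mathbb{A}=\mathbb{A}_1\sqcup\cdots\sqcup\mathbb{A}_n$. Let $\mathcal{R}$ be the kernel of the natural map $\mathsf{S}(\mathbb{A})\to A$, where $\mathsf{S}(\mathbb{A})$ is the symmetric (polynomial) algebra over $k$ with set of indeterminates $\mathbb{A}$. Then the ideal $\mathcal{R}$ is generated by the straightening relations of the minimally non-standard monomials, i.e. by the elements $m'-\sum_m a_m m\in\mathsf{S}(\mathbb{A})$, where $m'$ runs over the minimally non-standard monomials and $m'=\sum_m a_m m$ (in $A$) is the straightening relation of $m'$.
   Context: Let $\mathbb{A}_1,\dots,\mathbb{A}_n$ be disjoint finite subsets of $A$, and $\mathbb{A}=\mathbb{A}_1\sqcup\cdots\sqcup\mathbb{A}_n$ (called a multiset). A formal monomial is a monomial in the elements of $\mathbb{A}$ in the free associative algebra on $\mathbb{A}$; a monomial is a commutative monomial in $\mathsf{S}(\mathbb{A})$. The shape of $a\in\mathbb{A}_i$ is $i$; the shape of a formal monomial $a_1a_2\cdots a_N$ is $(i_1,\dots,i_N)$, where $i_h$ is the shape of $a_h$. Let $\longleftarrow$ be a binary relation on $\mathbb{A}$ which is antisymmetric and transitive when restricted to each $\mathbb{A}_i$. A formal monomial $a_1\cdots a_N$ is weakly standard if $a_1\longleftarrow a_2\longleftarrow\cdots\longleftarrow a_N$. For all $i,j$ let $\phi_{i,j}$ (swap maps) be a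 map from the set of weakly standard formal monomials of shape $(i,j)$ to the set of weakly standard formal monomials of shape $(j,i)$, such that $\phi_{i,i}=\mathrm{Id}$ and $\phi_{i,j}\phi_{j,i}=\mathrm{Id}$. Swapping an adjacent pair $a_ja_{j+1}$ in a weakly standard formal monomial $a_1\cdots a_N$ means replacing that pair by its image under the appropriate swap map; if the result is weakly standard one can swap again, and so on. A formal monomial is standard if its shape is a non-decreasing sequence, it is weakly standard, and all formal monomials obtained from it by repeated swaps are weakly standard. A monomial in $\mathsf{S}(\mathbb{A})$ is weakly standard (resp. standard) if it is the image of a weakly standard (resp. standard) formal monomial. $(\mathbb{A},\phi_{i,j},\longleftarrow)$ is a standard monomial theory on the multiset $\mathbb{A}$ for $A$ if the images in $A$ of the standard monomials of $\mathsf{S}(\mathbb{A})$ are all distinct and form a $k$-basis of $A$. Let $\leq$ be a (partial) order on commutative monomials in $\mathbb{A}$ such that: (i) if $m'\leq m''$ then $mm'\leq mm''$ for all monomials $m$; (ii) for every monomial $m$ the set of monomials $m'$ with $m\leq m'$ is finite. For a non-standard monomial $m'$ there is a unique expression $m'=\sum_m a_m m$ in $A$ as a $k$-linear combination of standard monomials $m$; it is called a straightening relation for $m'$ if $m'\leq m$ whenever $a_m\neq0$. If every non-standard monomial has a straightening relation, then $(\mathbb{A},\phi_{i,j},\longleftarrow,\leq)$ is a standard monomial theory with straightening relations for $A$. A formal non-standard monomial $a_1a_2\cdots a_N$ is minimally non-standard if for every proper subsequence $1\leq i_1<\cdots<i_h\leq N$ of indices the formal monomial $a_{i_1}\cdots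 a_{i_h}$ is standard. A non-standard monomial in $\mathsf{S}(\mathbb{A})$ is minimally non-standard if it is the image of a minimally non-standard formal monomial. *)

theory Defs
  imports Complex_Main "HOL-Library.Poly_Mapping" "HOL-Library.Multiset" "HOL-Library.Sublist"
    "HOL-Algebra.Ideal"
begin

section \<open>Formal monomials and swaps\<close>

text \<open>
  The family \<open>\<A> 1, \<dots>, \<A> n\<close> consists of subsets of the algebra, its elements are the letters.
  A formal monomial is a word (list) in the letters, a commutative monomial is a (HOL) multiset of
  letters. The values of \<open>\<A>\<close> outside \<open>{1..n}\<close>, of the relation outside the letters and of the
  swap maps outside the weakly standard words of length two are irrelevant.
\<close>

locale swap_data =
  fixes n :: nat
    and \<A> :: "nat \<Rightarrow> 'a set"
    and arrow :: "'a \<Rightarrow> 'a \<Rightarrow> bool"  (infix \<open>\<longleftarrow>\<close> 50)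
    and \<phi> :: "nat \<Rightarrow> nat \<Rightarrow> 'a list \<Rightarrow> 'a list"
begin

definition letters :: "'a set" where
  "letters = (\<Union>i\<in>{1..n}. \<A> i)"

definition shape :: "'a \<Rightarrow> nat" where
  "shape a = (THE i. i \<in> {1..n} \<and> a \<in> \<A> i)"

definition formal_monomial :: "'a list \<Rightarrow> bool" where
  "formal_monomial w \<longleftrightarrow> set w \<subseteq> letters"

definition weakly_standard_formal :: "'a list \<Rightarrow> bool" where
  "weakly_standard_formal w \<longleftrightarrow> formal_monomial w \<and> successively (\<longleftarrow>) w"

definition weakly_standard_of_shape :: "nat list \<Rightarrow> 'a list set" where
  "weakly_standard_of_shape s = {w. weakly_standard_formal w \<and> map shape w = s}"

inductive swap :: "'a list \<Rightarrow> 'a list \<Rightarrow> bool" where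
  "weakly_standard_formal (u @ [a, b] @ v) \<Longrightarrow>
     swap (u @ [a, b] @ v) (u @ \<phi> (shape a) (shape b) [a, b] @ v)"

definition standard_formal :: "'a list \<Rightarrow> bool" where
  "standard_formal w \<longleftrightarrow>
     sorted (map shape w) \<and> weakly_standard_formal w \<and>
     (\<forall>w'. swap\<^sup>*\<^sup>* w w' \<longrightarrow> weakly_standard_formal w')"

definition minimally_nonstandard_formal :: "'a list \<Rightarrow> bool" where
  "minimally_nonstandard_formal w \<longleftrightarrow>
     formal_monomial w \<and> \<not> standard_formal w \<and>
     (\<forall>v. strict_subseq v w \<longrightarrow> standard_formal v)"

definition monomials :: "'a multiset set" where
  "monomials = {m. set_mset m \<subseteq> letters}"

definition standard_monomials :: "'a multiset set" where
  "standard_monomials = {mset w | w. standard_formal w}"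

definition nonstandard_monomials :: "'a multiset set" where
  "nonstandard_monomials = monomials - standard_monomials"

definition minimally_nonstandard_monomials :: "'a multiset set" where
  "minimally_nonstandard_monomials =
     {m \<in> nonstandard_monomials. \<exists>w. mset w = m \<and> minimally_nonstandard_formal w}"

end

locale swap_system = swap_data +
  assumes finite_letters: "i \<in> {1..n} \<Longrightarrow> finite (\<A> i)"
    and disjoint_letters: "i \<in> {1..n} \<Longrightarrow> j \<in> {1..n} \<Longrightarrow> i \<noteq> j \<Longrightarrow> \<A> i \<inter> \<A> j = {}"
    and arrow_antisym: "i \<in> {1..n} \<Longrightarrow> antisymp_on (\<A> i) (\<longleftarrow>)"
    and arrow_trans: "i \<in> {1..n} \<Longrightarrow> transp_on (\<A> i) (\<longleftarrow>)"
    and swap_maps: "i \<in> {1..n} \<Longrightarrow> j \<in> {1..n} \<Longrightarrow>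
      \<phi> i j \<in> weakly_standard_of_shape [i, j] \<rightarrow> weakly_standard_of_shape [j, i]"
    and swap_same: "i \<in> {1..n} \<Longrightarrow> w \<in> weakly_standard_of_shape [i, i] \<Longrightarrow> \<phi> i i w = w"
    and swap_inverse: "i \<in> {1..n} \<Longrightarrow> j \<in> {1..n} \<Longrightarrow> w \<in> weakly_standard_of_shape [j, i] \<Longrightarrow>
      \<phi> i j (\<phi> j i w) = w"


section \<open>The polynomial algebra on a set of elements of an algebra\<close>

locale comm_algebra = vector_space scale
  for scale :: "'k::field \<Rightarrow> 'a::comm_ring_1 \<Rightarrow> 'a" +
  assumes scale_mult_left: "scale c x * y = scale c (x * y)"

text \<open>
  The type \<open>'a multiset \<Rightarrow>\<^sub>0 'k\<close> of finitely supported functions, with the convolution product, is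
  the polynomial ring over \<open>'k\<close> with all elements of \<open>'a\<close> as indeterminates. The symmetric algebra
  on \<open>V\<close> is the subring of the polynomials that only involve the indeterminates in \<open>V\<close>.
\<close>

definition sym_algebra :: "'a set \<Rightarrow> ('a multiset \<Rightarrow>\<^sub>0 'k::field) ring" where
  "sym_algebra V =
     \<lparr>carrier = {p. \<forall>m\<in>Poly_Mapping.keys p. set_mset m \<subseteq> V}, mult = (*), one = 1, zero = 0, add = (+)\<rparr>"

definition eval_poly ::
  "('k::field \<Rightarrow> 'a::comm_ring_1 \<Rightarrow> 'a) \<Rightarrow> ('a multiset \<Rightarrow>\<^sub>0 'k) \<Rightarrow> 'a" where
  "eval_poly scale p = (\<Sum>m\<in>Poly_Mapping.keys p. scale (Poly_Mapping.lookup p m) (\<Prod>\<^sub># m))"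

lemma cring_sym_algebra: "cring (sym_algebra V)"
proof (rule cringI)
  show "abelian_group (sym_algebra V)"
  proof (rule abelian_groupI)
    fix x assume x: "x \<in> carrier (sym_algebra V)"
    then show "\<exists>y\<in>carrier (sym_algebra V). y \<oplus>\<^bsub>sym_algebra V\<^esub> x = \<zero>\<^bsub>sym_algebra V\<^esub>"
      by (intro bexI[of _ "- x"]) (auto simp: sym_algebra_def keys_def)
  qed (use keys_add in \<open>fastforce simp: sym_algebra_def algebra_simps\<close>)+
  show "comm_monoid (sym_algebra V)"
    by (rule comm_monoidI) (use keys_mult in \<open>fastforce simp: sym_algebra_def algebra_simps\<close>)+
qed (simp add: sym_algebra_def algebra_simps)

lemma poly_mapping_induct [case_names single add]:
  fixes p :: "'b \<Rightarrow>\<^sub>0 'c::monoid_add"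
  assumes single: "\<And>m c. P (Poly_Mapping.single m c)"
    and add: "\<And>p q. P p \<Longrightarrow> P q \<Longrightarrow> P (p + q)"
  shows "P p"
proof (induction p rule: update_induct)
  case const
  show ?case using single[of undefined 0] by simp
next
  case (update f a b)
  then have "Poly_Mapping.update a b f = f + Poly_Mapping.single a b"
    by (intro poly_mapping_eqI) (auto simp: lookup_update lookup_add lookup_single in_keys_iff)
  then show ?case using add[OF update(3) single] by simp
qed

context comm_algebra
begin

lemma eval_poly_superset:
  assumes "finite M" "Poly_Mapping.keys p \<subseteq> M"
  shows "eval_poly scale p = (\<Sum>m\<in>M. scale (Poly_Mapping.lookup p m) (\<Prod>\<^sub># m))"
  unfolding eval_poly_def
  by (rule sum.mono_neutral_left) (use assms in \<open>auto simp: in_keys_iff\<close>)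

lemma eval_poly_single: "eval_poly scale (Poly_Mapping.single m c) = scale c (\<Prod>\<^sub># m)"
  by (subst eval_poly_superset[of "{m}"]) auto

lemma eval_poly_add: "eval_poly scale (p + q) = eval_poly scale p + eval_poly scale q"
proof -
  let ?M = "Poly_Mapping.keys p \<union> Poly_Mapping.keys q"
  show ?thesis
    using keys_add[of p q]
    by (simp add: eval_poly_superset[of ?M] lookup_add scale_left_distrib sum.distrib)
qed

lemma eval_poly_one: "eval_poly scale 1 = 1"
  using eval_poly_single[of "{#}" 1] by (simp add: single_one[symmetric] del: single_one)

lemma eval_poly_mult: "eval_poly scale (p * q) = eval_poly scale p * eval_poly scale q"
proof (induction p rule: poly_mapping_induct)
  case (single m c)
  show ?case
  proof (induction q rule: poly_mapping_induct)
    case (single l d)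
    have "scale (c * d) (x * y) = scale c x * scale d y" for x y
      by (metis mult.commute scale_mult_left scale_scale)
    then show ?case by (simp add: mult_single eval_poly_single)
  qed (simp add: distrib_left eval_poly_add)
qed (simp add: distrib_right eval_poly_add)

end


section \<open>Standard monomial theories\<close>

locale standard_monomial_theory =
  comm_algebra scale + swap_system n \<A> arrow \<phi>
  for scale :: "'k::field \<Rightarrow> 'a::comm_ring_1 \<Rightarrow> 'a"
    and n :: nat
    and \<A> :: "nat \<Rightarrow> 'a set"
    and arrow :: "'a \<Rightarrow> 'a \<Rightarrow> bool"  (infix \<open>\<longleftarrow>\<close> 50)
    and \<phi> :: "nat \<Rightarrow> nat \<Rightarrow> 'a list \<Rightarrow> 'a list" +
  assumes standard_distinct: "inj_on prod_mset standard_monomials"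
    and standard_independent: "independent (prod_mset ` standard_monomials)"
    and standard_span: "span (prod_mset ` standard_monomials) = UNIV"

text \<open>
  The straightening relation of a non-standard monomial \<open>m'\<close> is recorded by the polynomial
  \<open>p = (\<Sum>m. a\<^sub>m m)\<close> that is its unique expression through standard monomials.
\<close>

definition straightening_relation ::
  "('k::field \<Rightarrow> 'a::comm_ring_1 \<Rightarrow> 'a) \<Rightarrow> nat \<Rightarrow> (nat \<Rightarrow> 'a set) \<Rightarrow> ('a \<Rightarrow> 'a \<Rightarrow> bool) \<Rightarrow>
   (nat \<Rightarrow> nat \<Rightarrow> 'a list \<Rightarrow> 'a list) \<Rightarrow> ('a multiset \<Rightarrow> 'a multiset \<Rightarrow> bool) \<Rightarrow>
   'a multiset \<Rightarrow> ('a multiset \<Rightarrow>\<^sub>0 'k) \<Rightarrow> bool" where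
  "straightening_relation scale n \<A> arrow \<phi> leq m' p \<longleftrightarrow>
     m' \<in> swap_data.nonstandard_monomials n \<A> arrow \<phi> \<and>
     Poly_Mapping.keys p \<subseteq> swap_data.standard_monomials n \<A> arrow \<phi> \<and>
     \<Prod>\<^sub># m' = eval_poly scale p \<and>
     (\<forall>m\<in>Poly_Mapping.keys p. leq m' m)"

locale straightening_monomial_theory =
  standard_monomial_theory scale n \<A> arrow \<phi>
  for scale :: "'k::field \<Rightarrow> 'a::comm_ring_1 \<Rightarrow> 'a"
    and n :: nat
    and \<A> :: "nat \<Rightarrow> 'a set"
    and arrow :: "'a \<Rightarrow> 'a \<Rightarrow> bool"  (infix \<open>\<longleftarrow>\<close> 50)
    and \<phi> :: "nat \<Rightarrow> nat \<Rightarrow> 'a list \<Rightarrow> 'a list" +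
  fixes leq :: "'a multiset \<Rightarrow> 'a multiset \<Rightarrow> bool"  (infix \<open>\<preceq>\<close> 50)
  assumes le_refl: "reflp_on monomials (\<preceq>)"
    and le_antisym: "antisymp_on monomials (\<preceq>)"
    and le_trans: "transp_on monomials (\<preceq>)"
    and le_mult: "m \<in> monomials \<Longrightarrow> m' \<in> monomials \<Longrightarrow> m'' \<in> monomials \<Longrightarrow> m' \<preceq> m'' \<Longrightarrow>
      m + m' \<preceq> m + m''"
    and le_finite: "m \<in> monomials \<Longrightarrow> finite {m' \<in> monomials. m \<preceq> m'}"
    and straightening: "m' \<in> nonstandard_monomials \<Longrightarrow>
      \<exists>p. straightening_relation scale n \<A> (\<longleftarrow>) \<phi> (\<preceq>) m' p"

end

theory Submission
  imports Defs
begin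

text \<open>
  Words sorted by shape and, within one shape, by the arrow are determined by their content, so a
  standard word is recovered from its commutative monomial. A non-standard monomial that is minimal
  under divisibility therefore has an arrangement all of whose proper subsequences are standard: every
  non-standard monomial is a multiple of a minimally non-standard one. Rewriting with the corresponding
  relations yields strictly larger monomials, so it terminates because up-sets are finite, and it
  expresses every polynomial through standard monomials modulo the relations; these are
  linearly independent in the algebra, so an element of the kernel is rewritten to zero.
\<close>

section \<open>Sorted arrangements of a multiset\<close>

text \<open>Insertion sort for a relation that is total only on the pairs of \<open>m\<close>.
  Phrasing comparability through \<open>{#x, y#} \<subseteq># m\<close> asks for
  \<open>R x x\<close> exactly when \<open>x\<close> occurs at least twice, so the irreflexive
  letters of a multiplicity-free monomial cause no trouble.\<close>

lemma sorted_wrt_arrangement_exists: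
  assumes "\<And>x y. {#x, y#} \<subseteq># m \<Longrightarrow> R x y \<or> R y x" and "transp_on (set_mset m) R"
  shows "\<exists>w. mset w = m \<and> sorted_wrt R w"
  using assms
proof (induction m)
  case empty
  then show ?case by simp
next
  case (add a m)
  have "{#x, y#} \<subseteq># add_mset a m" if "{#x, y#} \<subseteq># m" for x y
    using that by (rule subset_mset.order_trans) simp
  then obtain w where w: "mset w = m" "sorted_wrt R w"
    using add.IH add.prems transp_on_subset[OF add.prems(2), of "set_mset m"] by auto
  \<comment> \<open>The new letter \<open>a\<close> goes between those related to it and the rest. A
    letter of \<open>?r\<close> is not \<open>R\<close>-before \<open>a\<close>, so comparability
    puts it after \<open>a\<close>, and transitivity through \<open>a\<close> relates
    \<open>?l\<close> to \<open>?r\<close>.\<close>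
  let ?l = "filter (\<lambda>x. R x a) w" and ?r = "filter (\<lambda>x. \<not> R x a) w"
  have a_r: "R a y" if "y \<in> set ?r" for y
  proof -
    have "{#a, y#} \<subseteq># add_mset a m" using that w(1) by auto
    then show ?thesis using add.prems(1)[of a y] that by auto
  qed
  have "R x y" if "x \<in> set ?l" "y \<in> set ?r" for x y
    using transp_onD[OF add.prems(2), of x a y] a_r[OF that(2)] that w(1) by auto
  then have "\<forall>x\<in>set ?l. \<forall>y\<in>set (a # ?r). R x y" by simp
  moreover have "sorted_wrt R (a # ?r)" "sorted_wrt R ?l"
    using a_r w(2) by (simp_all add: sorted_wrt_filter)
  ultimately have "sorted_wrt R (?l @ a # ?r)"
    unfolding sorted_wrt_append by blast
  moreover have "mset (?l @ a # ?r) = add_mset a m"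
    using w(1) by simp
  ultimately show ?case by blast
qed

text \<open>If the first letters \<open>a\<close> and \<open>b\<close> differed, each would occur
  later in the other word, so \<open>R a b\<close> and \<open>R b a\<close> would contradict
  antisymmetry; hence the heads agree and can be removed.\<close>

lemma sorted_wrt_arrangement_unique:
  assumes "antisymp_on (set v) R" "sorted_wrt R v" "sorted_wrt R w" "mset v = mset w"
  shows "v = w"
  using assms
proof (induction v arbitrary: w)
  case Nil
  then show ?case by simp
next
  case (Cons a v)
  then obtain b w' where w: "w = b # w'" by (cases w) auto
  have sets: "set (a # v) = set w" using Cons.prems(4) by (rule mset_eq_setD)
  have "a = b"
  proof (rule ccontr)
    assume "a \<noteq> b"
    then have "a \<in> set w'" "b \<in> set v" using sets w by auto
    then have "R a b" "R b a" using Cons.prems w by auto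
    then show False
      using antisymp_onD[OF Cons.prems(1)] \<open>b \<in> set v\<close> \<open>a \<noteq> b\<close> by auto
  qed
  moreover have "v = w'"
    using Cons.prems w \<open>a = b\<close> antisymp_on_subset[OF Cons.prems(1), of "set v"]
    by (intro Cons.IH) auto
  ultimately show ?case using w by simp
qed

lemma subseq_mset:
  assumes "subseq v w"
  shows "mset v \<subseteq># mset w"
  using assms
proof (induction rule: list_emb.induct)
  case (list_emb_Cons v w a)
  show ?case using list_emb_Cons.IH by (rule subset_mset.order_trans) simp
qed simp_all

lemma sorted_wrt_subseq:
  assumes "subseq v w" "sorted_wrt R w"
  shows "sorted_wrt R v"
  using assms
proof (induction rule: list_emb.induct)
  case (list_emb_Cons2 x y xs ys)
  then show ?case using list_emb_set[of "(=)" xs ys] by fastforce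
qed auto

lemma strict_subseq_mset:
  assumes "strict_subseq v w"
  shows "mset v \<subset># mset w"
proof -
  have "mset v \<subseteq># mset w" using assms by (simp add: subseq_mset)
  moreover have "mset v \<noteq> mset w"
  proof
    assume "mset v = mset w"
    then have "length v = length w" by (rule mset_eq_length)
    then show False using assms subseq_same_length[of v w] by (simp add: subseq_order.less_le)
  qed
  ultimately show ?thesis by (simp add: subset_mset.less_le)
qed

section \<open>Standard words and minimally non-standard divisors\<close>

context swap_system
begin

lemma shape_unique:
  assumes "i \<in> {1..n}" "a \<in> \<A> i"
  shows "shape a = i"
  unfolding shape_def
proof (rule the_equality)
  fix j assume "j \<in> {1..n} \<and> a \<in> \<A> j"
  then show "j = i" using disjoint_letters[of i j] assms by blast
qed (use assms in simp)

lemma letters_shape: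
  assumes "a \<in> letters"
  shows "shape a \<in> {1..n}" "a \<in> \<A> (shape a)"
proof -
  obtain i where i: "i \<in> {1..n}" "a \<in> \<A> i"
    using assms unfolding letters_def by blast
  then have "shape a = i" by (rule shape_unique)
  then show "shape a \<in> {1..n}" "a \<in> \<A> (shape a)" using i by simp_all
qed

text \<open>Lexicographic comparison, shape first. The arrow is assumed transitive and antisymmetric
  only inside each \<open>\<A> i\<close>; this relation is so on all letters, which sorting
  requires.\<close>

definition shape_arrow :: "'a \<Rightarrow> 'a \<Rightarrow> bool" where
  "shape_arrow a b \<longleftrightarrow> shape a < shape b \<or> shape a = shape b \<and> a \<longleftarrow> b"

lemma transp_on_shape_arrow: "transp_on letters shape_arrow"
proof (rule transp_onI)
  fix a b c assume *: "a \<in> letters" "b \<in> letters" "c \<in> letters"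
    "shape_arrow a b" "shape_arrow b c"
  show "shape_arrow a c"
    using *(4,5) transp_onD[OF arrow_trans[OF letters_shape(1)[OF *(1)]], of a b c]
      letters_shape(2)[OF *(1)] letters_shape(2)[OF *(2)] letters_shape(2)[OF *(3)]
    unfolding shape_arrow_def by auto
qed

lemma antisymp_on_shape_arrow: "antisymp_on letters shape_arrow"
proof (rule antisymp_onI)
  fix a b assume *: "a \<in> letters" "b \<in> letters" "shape_arrow a b" "shape_arrow b a"
  have "shape b \<le> shape a" "shape a \<le> shape b"
    using *(3,4) unfolding shape_arrow_def by linarith+
  then have eq: "shape b = shape a" by simp
  show "a = b"
  proof (rule antisymp_onD[OF arrow_antisym[OF letters_shape(1)[OF *(1)]]])
    show "a \<in> \<A> (shape a)" "b \<in> \<A> (shape a)"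
      using letters_shape(2)[OF *(1)] letters_shape(2)[OF *(2)] eq by simp_all
    show "a \<longleftarrow> b" "b \<longleftarrow> a"
      using *(3,4) eq unfolding shape_arrow_def by simp_all
  qed
qed

lemma standard_formal_letters: "standard_formal w \<Longrightarrow> set w \<subseteq> letters"
  unfolding standard_formal_def weakly_standard_formal_def formal_monomial_def by simp

lemma standard_monomials_subset: "standard_monomials \<subseteq> monomials"
  unfolding standard_monomials_def monomials_def by (auto dest!: standard_formal_letters)

text \<open>Weak standardness and the sorted shape compare adjacent letters only; transitivity of
  \<open>shape_arrow\<close> extends this to all pairs.\<close>

lemma standard_formal_sorted:
  assumes "standard_formal w"
  shows "sorted_wrt shape_arrow w"
proof -
  have "successively shape_arrow w"
    unfolding successively_conv_nth
  proof (intro allI impI)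
    fix i assume i: "Suc i < length w"
    have "w ! i \<longleftarrow> w ! Suc i"
      using assms i unfolding standard_formal_def weakly_standard_formal_def successively_conv_nth
      by blast
    moreover have "shape (w ! i) \<le> shape (w ! Suc i)"
      using assms i sorted_nth_mono[of "map shape w" i "Suc i"] unfolding standard_formal_def by simp
    ultimately show "shape_arrow (w ! i) (w ! Suc i)" unfolding shape_arrow_def by auto
  qed
  moreover have "transp_on (set w) shape_arrow"
    using transp_on_shape_arrow standard_formal_letters[OF assms] by (rule transp_on_subset)
  ultimately show ?thesis
    by (subst (asm) successively_iff_sorted_wrt_strong) (auto dest: transp_onD)
qed

text \<open>Among the non-standard divisors of \<open>m\<close> one of least size has only standard
  proper divisors. It remains to order its letters so that each proper subsequence is the standard
  word of its own content.\<close>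

lemma minimally_nonstandard_divisor:
  assumes "m \<in> nonstandard_monomials"
  obtains m' where "m' \<subseteq># m" "m' \<in> minimally_nonstandard_monomials"
proof -
  obtain m' where m': "m' \<in> nonstandard_monomials" "m' \<subseteq># m"
    and least: "\<And>l. l \<in> nonstandard_monomials \<Longrightarrow> l \<subseteq># m \<Longrightarrow> size m' \<le> size l"
    using ex_has_least_nat[of "\<lambda>l. l \<in> nonstandard_monomials \<and> l \<subseteq># m" m size] assms by auto
  have letters: "set_mset m' \<subseteq> letters"
    using m'(1) unfolding nonstandard_monomials_def monomials_def by simp
  have proper: "l \<in> standard_monomials" if "l \<subset># m'" for l
  proof (rule ccontr)
    assume "l \<notin> standard_monomials"
    moreover have "l \<in> monomials"
      using that letters set_mset_mono[of l m'] unfolding monomials_def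
      by (auto simp: subset_mset.less_imp_le)
    ultimately have "size m' \<le> size l"
      using least that m'(2) unfolding nonstandard_monomials_def
      by (metis DiffI subset_mset.less_imp_le subset_mset.order_trans)
    then show False using mset_subset_size[OF that] by simp
  qed
  \<comment> \<open>In size above two every pair of letters is a proper divisor, hence standard,
    hence comparable, and sorting is possible. In size at most two the letters may be incomparable,
    but any order will do, since proper subsequences have at most one letter.\<close>
  obtain w where w: "mset w = m'" "size m' \<le> 2 \<or> sorted_wrt shape_arrow w"
  proof (cases "size m' \<le> 2")
    case True
    then show ?thesis using that ex_mset[of m'] by blast
  next
    case False
    have "shape_arrow x y \<or> shape_arrow y x" if "{#x, y#} \<subseteq># m'" for x y
    proof -
      have "{#x, y#} \<subset># m'" using that False by (auto simp: subset_mset.less_le)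
      then obtain v where v: "mset v = {#x, y#}" "standard_formal v"
        using proper unfolding standard_monomials_def by force
      have "length v = 2" using v(1) by (simp flip: size_mset)
      then obtain a b where "v = [a, b]" by (auto simp: numeral_2_eq_2 length_Suc_conv)
      then have "v = [x, y] \<or> v = [y, x]" using v(1) by (auto simp: add_eq_conv_ex)
      then show ?thesis using standard_formal_sorted[OF v(2)] by auto
    qed
    then show ?thesis
      using sorted_wrt_arrangement_exists[of m' shape_arrow] that
        transp_on_subset[OF transp_on_shape_arrow letters] by blast
  qed
  have "standard_formal v" if "strict_subseq v w" for v
  proof -
    have sub: "mset v \<subset># m'" using strict_subseq_mset[OF that] w(1) by simp
    \<comment> \<open>That the content of \<open>v\<close> is standard provides only some standard
      arrangement \<open>v'\<close>. Both words are sorted by \<open>shape_arrow\<close>, so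
      uniqueness identifies them.\<close>
    then obtain v' where v': "mset v' = mset v" "standard_formal v'"
      using proper unfolding standard_monomials_def by force
    have "sorted_wrt shape_arrow v"
      using w(2)
    proof
      assume "size m' \<le> 2"
      then have "length v \<le> 1" using mset_subset_size[OF sub] by simp
      then show ?thesis by (cases v) auto
    next
      assume "sorted_wrt shape_arrow w"
      then show ?thesis by (rule sorted_wrt_subseq[OF subseq_order.strict_implies_order[OF that]])
    qed
    then have "v' = v"
      using sorted_wrt_arrangement_unique[of v' shape_arrow v] standard_formal_sorted v'
        antisymp_on_subset[OF antisymp_on_shape_arrow standard_formal_letters[OF v'(2)]] by blast
    then show ?thesis using v'(2) by simp
  qed
  moreover have "\<not> standard_formal w"
    using m'(1) w(1) unfolding nonstandard_monomials_def standard_monomials_def by blast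
  moreover have "formal_monomial w"
    using letters w(1) unfolding formal_monomial_def by auto
  ultimately have "m' \<in> minimally_nonstandard_monomials"
    using m'(1) w(1)
    unfolding minimally_nonstandard_monomials_def minimally_nonstandard_formal_def by blast
  then show ?thesis using that m'(2) by blast
qed

end

section \<open>The evaluation kernel and independence of standard monomials\<close>

lemma poly_mapping_eq_sum_single:
  "p = (\<Sum>m\<in>Poly_Mapping.keys p. Poly_Mapping.single m (Poly_Mapping.lookup p m))"
  by (rule poly_mapping_eqI) (simp add: lookup_sum lookup_single when_def in_keys_iff)

lemma sym_algebra_simps [simp]:
  "p \<in> carrier (sym_algebra V) \<longleftrightarrow> (\<forall>m\<in>Poly_Mapping.keys p. set_mset m \<subseteq> V)"
  "p \<otimes>\<^bsub>sym_algebra V\<^esub> q = p * q"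
  "p \<oplus>\<^bsub>sym_algebra V\<^esub> q = p + q"
  "\<one>\<^bsub>sym_algebra V\<^esub> = 1"
  "\<zero>\<^bsub>sym_algebra V\<^esub> = 0"
  by (simp_all add: sym_algebra_def)

text \<open>The inverse on the left is the one defined by the group law of the record; uniqueness of
  inverses identifies it with negation of polynomials.\<close>

lemma sym_algebra_a_inv:
  assumes "p \<in> carrier (sym_algebra V)"
  shows "\<ominus>\<^bsub>sym_algebra V\<^esub> p = - p"
proof -
  interpret cring "sym_algebra V" by (rule cring_sym_algebra)
  have "- p \<in> carrier (sym_algebra V)" using assms by (simp add: keys_def)
  then show ?thesis using assms minus_equality[of "- p" p] by simp
qed

context comm_algebra
begin

lemma eval_poly_zero: "eval_poly scale 0 = 0"
  by (simp add: eval_poly_def)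

lemma eval_poly_uminus: "eval_poly scale (- p) = - eval_poly scale p"
  using eval_poly_add[of p "- p"] by (intro minus_unique[symmetric]) (simp add: eval_poly_zero)

lemma eval_poly_diff: "eval_poly scale (p - q) = eval_poly scale p - eval_poly scale q"
  using eval_poly_add[of p "- q"] by (simp add: eval_poly_uminus)

lemma ideal_kernel:
  "ideal {f \<in> carrier (sym_algebra V). eval_poly scale f = 0} (sym_algebra V)"
proof -
  let ?S = "sym_algebra V :: ('a multiset \<Rightarrow>\<^sub>0 'k) ring"
  let ?K = "{f \<in> carrier ?S. eval_poly scale f = 0}"
  interpret cring ?S by (rule cring_sym_algebra)
  show ?thesis
  proof (rule idealI)
    show "subgroup ?K (add_monoid ?S)"
    proof (rule add.subgroupI)
      show "\<ominus>\<^bsub>?S\<^esub> a \<in> ?K" if "a \<in> ?K" for a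
        using that a_inv_closed[of a] sym_algebra_a_inv[of a V]
        by (simp del: sym_algebra_simps(1) add: eval_poly_uminus)
      show "?K \<noteq> {}"
        using zero_closed eval_poly_zero by (intro notI) (auto simp del: sym_algebra_simps(1))
      show "a \<oplus>\<^bsub>?S\<^esub> b \<in> ?K" if "a \<in> ?K" "b \<in> ?K" for a b
        using that a_closed[of a b] by (simp del: sym_algebra_simps(1) add: eval_poly_add)
    qed blast
    show "x \<otimes>\<^bsub>?S\<^esub> a \<in> ?K" "a \<otimes>\<^bsub>?S\<^esub> x \<in> ?K" if "a \<in> ?K" "x \<in> carrier ?S" for a x
      using that m_closed[of a x] m_closed[of x a]
      by (simp_all del: sym_algebra_simps(1) add: eval_poly_mult)
  qed (rule ring_axioms)
qed

end

context standard_monomial_theory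
begin

text \<open>Distinct standard monomials have distinct images, so the vanishing evaluation is a
  genuine linear relation between distinct basis vectors, with the coefficients of
  \<open>p\<close>.\<close>

lemma standard_combination_zero:
  assumes "Poly_Mapping.keys p \<subseteq> standard_monomials" "eval_poly scale p = 0"
  shows "p = 0"
proof (rule poly_mapping_eqI)
  fix m
  let ?K = "Poly_Mapping.keys p"
  have inj: "inj_on prod_mset ?K"
    using standard_distinct assms(1) by (rule inj_on_subset)
  \<comment> \<open>Linear independence speaks of coefficients attached to vectors, so
    \<open>u\<close> assigns to a product the coefficient of the only monomial of \<open>p\<close>
    with that product.\<close>
  define u where "u = (\<lambda>x. Poly_Mapping.lookup p (the_inv_into ?K prod_mset x))"
  have u: "u (\<Prod>\<^sub># m) = Poly_Mapping.lookup p m" if "m \<in> ?K" for m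
    using that by (simp add: u_def the_inv_into_f_f[OF inj])
  have "(\<Sum>x\<in>prod_mset ` ?K. scale (u x) x) = 0"
    using assms(2) u by (simp add: sum.reindex[OF inj] eval_poly_def)
  moreover have "independent (prod_mset ` ?K)"
    using standard_independent image_mono[OF assms(1)] by (rule independent_mono)
  ultimately have "u (\<Prod>\<^sub># m) = 0" if "m \<in> ?K"
    using that independentD[of "prod_mset ` ?K" "prod_mset ` ?K" u "\<Prod>\<^sub># m"] by simp
  then show "Poly_Mapping.lookup p m = Poly_Mapping.lookup 0 m"
    using u[of m] by (cases "m \<in> ?K") (auto simp: in_keys_iff)
qed

end

section \<open>Reduction modulo the minimal relations\<close>

context straightening_monomial_theory
begin

text \<open>By \<open>standard_combination_zero\<close> a monomial \<open>m'\<close> has at most one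
  \<open>p\<close>, so this is one generator for each minimally non-standard monomial.\<close>

definition minimal_relations :: "('a multiset \<Rightarrow>\<^sub>0 'k) set" where
  "minimal_relations = {Poly_Mapping.single m' 1 - p | m' p.
     m' \<in> minimally_nonstandard_monomials \<and>
     straightening_relation scale n \<A> (\<longleftarrow>) \<phi> (\<preceq>) m' p}"

abbreviation relation_ideal :: "('a multiset \<Rightarrow>\<^sub>0 'k) set" where
  "relation_ideal \<equiv> genideal (sym_algebra letters) minimal_relations"

text \<open>Used twice: the generators lie in the carrier, so that they generate an ideal containing
  them, and that ideal stays inside the kernel.\<close>

lemma minimal_relations_kernel:
  "minimal_relations \<subseteq> {f \<in> carrier (sym_algebra letters). eval_poly scale f = 0}"
proof
  fix f assume "f \<in> minimal_relations"
  then obtain m p where f: "f = Poly_Mapping.single m 1 - p"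
    and p: "straightening_relation scale n \<A> (\<longleftarrow>) \<phi> (\<preceq>) m p"
    unfolding minimal_relations_def by blast
  have "insert m (Poly_Mapping.keys p) \<subseteq> monomials"
    using p standard_monomials_subset
    unfolding straightening_relation_def nonstandard_monomials_def by auto
  moreover have "Poly_Mapping.keys f \<subseteq> insert m (Poly_Mapping.keys p)"
    unfolding f using keys_diff[of "Poly_Mapping.single m 1" p] by (auto split: if_splits)
  ultimately have "f \<in> carrier (sym_algebra letters)"
    unfolding monomials_def by auto
  moreover have "eval_poly scale f = 0"
    using p unfolding f straightening_relation_def by (simp add: eval_poly_diff eval_poly_single)
  ultimately show "f \<in> {f \<in> carrier (sym_algebra letters). eval_poly scale f = 0}" by simp
qed

lemma ideal_relation_ideal: "ideal relation_ideal (sym_algebra letters)"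
  using minimal_relations_kernel
  by (intro ring.genideal_ideal cring.axioms(1)[OF cring_sym_algebra]) auto

lemma relation_ideal_zero: "0 \<in> relation_ideal"
  using additive_subgroup.zero_closed[OF ideal.axioms(1)[OF ideal_relation_ideal]] by simp

lemma relation_ideal_add: "f \<in> relation_ideal \<Longrightarrow> g \<in> relation_ideal \<Longrightarrow> f + g \<in> relation_ideal"
  using additive_subgroup.a_closed[OF ideal.axioms(1)[OF ideal_relation_ideal], of f g] by simp

lemma relation_ideal_mult:
  "f \<in> carrier (sym_algebra letters) \<Longrightarrow> g \<in> relation_ideal \<Longrightarrow> f * g \<in> relation_ideal"
  using ideal.I_l_closed[OF ideal_relation_ideal, of g f] by simp

definition reducible :: "('a multiset \<Rightarrow>\<^sub>0 'k) \<Rightarrow> bool" where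
  "reducible f \<longleftrightarrow> (\<exists>g. Poly_Mapping.keys g \<subseteq> standard_monomials \<and> f - g \<in> relation_ideal)"

lemma reducible_congruent:
  assumes "f - g \<in> relation_ideal" "reducible g"
  shows "reducible f"
proof -
  obtain h where h: "Poly_Mapping.keys h \<subseteq> standard_monomials" "g - h \<in> relation_ideal"
    using assms(2) unfolding reducible_def by blast
  have "f - h \<in> relation_ideal" using relation_ideal_add[OF assms(1) h(2)] by simp
  then show ?thesis using h(1) unfolding reducible_def by blast
qed

lemma reducible_add:
  assumes "reducible f" "reducible g"
  shows "reducible (f + g)"
proof -
  obtain f' g' where *: "Poly_Mapping.keys f' \<subseteq> standard_monomials" "f - f' \<in> relation_ideal"
    "Poly_Mapping.keys g' \<subseteq> standard_monomials" "g - g' \<in> relation_ideal"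
    using assms unfolding reducible_def by blast
  have "Poly_Mapping.keys (f' + g') \<subseteq> standard_monomials"
    using *(1,3) keys_add[of f' g'] by blast
  moreover have "(f + g) - (f' + g') \<in> relation_ideal"
    using relation_ideal_add[OF *(2,4)] by (simp add: algebra_simps)
  ultimately show ?thesis unfolding reducible_def by blast
qed

lemma reducible_standard: "Poly_Mapping.keys f \<subseteq> standard_monomials \<Longrightarrow> reducible f"
  unfolding reducible_def using relation_ideal_zero by (intro exI[of _ f]) simp

lemma reducible_sum:
  assumes "finite M" "\<And>m. m \<in> M \<Longrightarrow> reducible (f m)"
  shows "reducible (sum f M)"
  using assms by (induction M) (simp_all add: reducible_add reducible_standard)

text \<open>One rewriting step: the relation of a minimally non-standard divisor \<open>d\<close> is
  multiplied by \<open>c\<close> times the cofactor \<open>e\<close>. The resulting terms need not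
  be standard, but they are strictly larger than \<open>m\<close>.\<close>

lemma nonstandard_reduction:
  assumes "m \<in> nonstandard_monomials"
  obtains p where "Poly_Mapping.single m c - p \<in> relation_ideal" "Poly_Mapping.keys p \<subseteq> monomials"
    "\<And>m'. m' \<in> Poly_Mapping.keys p \<Longrightarrow> m \<preceq> m' \<and> m \<noteq> m'"
proof -
  obtain d where d: "d \<subseteq># m" "d \<in> minimally_nonstandard_monomials"
    using minimally_nonstandard_divisor[OF assms] by blast
  define e where "e = m - d"
  have m: "m = e + d" using d(1) by (simp add: e_def)
  have d_nonstd: "d \<in> nonstandard_monomials"
    using d(2) unfolding minimally_nonstandard_monomials_def by simp
  obtain q where q: "straightening_relation scale n \<A> (\<longleftarrow>) \<phi> (\<preceq>) d q"
    using straightening[OF d_nonstd] by blast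
  have e_mon: "e \<in> monomials" and d_mon: "d \<in> monomials"
    using assms m unfolding nonstandard_monomials_def monomials_def by auto
  have q_std: "Poly_Mapping.keys q \<subseteq> standard_monomials"
    using q unfolding straightening_relation_def by simp
  let ?p = "Poly_Mapping.single e c * q"
  have keys: "\<exists>l\<in>Poly_Mapping.keys q. m' = e + l" if "m' \<in> Poly_Mapping.keys ?p" for m'
    using that keys_mult[of "Poly_Mapping.single e c" q] by (fastforce split: if_splits)
  have "Poly_Mapping.single d 1 - q \<in> minimal_relations"
    using d(2) q unfolding minimal_relations_def by blast
  then have "Poly_Mapping.single d 1 - q \<in> relation_ideal"
    using ring.genideal_self[OF cring.axioms(1)[OF cring_sym_algebra], of minimal_relations letters]
      minimal_relations_kernel by blast
  moreover have "Poly_Mapping.single e c \<in> carrier (sym_algebra letters)"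
    using e_mon unfolding monomials_def by simp
  ultimately have "Poly_Mapping.single e c * (Poly_Mapping.single d 1 - q) \<in> relation_ideal"
    by (intro relation_ideal_mult)
  then have "Poly_Mapping.single m c - ?p \<in> relation_ideal"
    by (simp add: m right_diff_distrib mult_single)
  moreover have "Poly_Mapping.keys ?p \<subseteq> monomials"
  proof
    fix m' assume "m' \<in> Poly_Mapping.keys ?p"
    then obtain l where "l \<in> monomials" "m' = e + l"
      using keys q_std standard_monomials_subset by blast
    then show "m' \<in> monomials" using e_mon unfolding monomials_def by simp
  qed
  moreover have "m \<preceq> m' \<and> m \<noteq> m'" if m': "m' \<in> Poly_Mapping.keys ?p" for m'
  proof -
    obtain l where l: "l \<in> Poly_Mapping.keys q" "m' = e + l" using keys[OF m'] by blast
    \<comment> \<open>Strictness: \<open>l\<close> is standard and \<open>d\<close> is not, so they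
      differ, and cancelling \<open>e\<close> shows that \<open>e + l\<close> differs from
      \<open>m\<close>.\<close>
    have "l \<in> standard_monomials" using l(1) q_std by blast
    then have "l \<in> monomials" "l \<noteq> d"
      using standard_monomials_subset d_nonstd unfolding nonstandard_monomials_def by auto
    moreover have "d \<preceq> l" using q l(1) unfolding straightening_relation_def by blast
    ultimately show ?thesis using le_mult[OF e_mon d_mon] l(2) m by auto
  qed
  ultimately show ?thesis using that by blast
qed

text \<open>Each rewriting step shrinks the finite set of monomials above \<open>m\<close>, so its
  cardinality is the induction measure. The coefficient is generalized because the new terms carry
  coefficients of their own.\<close>

lemma reducible_single:
  assumes "m \<in> monomials"
  shows "reducible (Poly_Mapping.single m c)"
  using assms
proof (induction "card {l \<in> monomials. m \<preceq> l}" arbitrary: m c rule: less_induct)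
  case less
  show ?case
  proof (cases "m \<in> standard_monomials")
    case True
    then show ?thesis by (intro reducible_standard) auto
  next
    case False
    then have "m \<in> nonstandard_monomials" using less.prems unfolding nonstandard_monomials_def by simp
    then obtain p where p: "Poly_Mapping.single m c - p \<in> relation_ideal"
      "Poly_Mapping.keys p \<subseteq> monomials"
      and above: "\<And>m'. m' \<in> Poly_Mapping.keys p \<Longrightarrow> m \<preceq> m' \<and> m \<noteq> m'"
      using nonstandard_reduction[of m c] by blast
    have "reducible (Poly_Mapping.single m' b)" if m': "m' \<in> Poly_Mapping.keys p" for m' b
    proof (rule less.hyps)
      show m'_mon: "m' \<in> monomials" using m' p(2) by blast
      have "{l \<in> monomials. m' \<preceq> l} \<subseteq> {l \<in> monomials. m \<preceq> l}"
        using above[OF m'] transp_onD[OF le_trans less.prems m'_mon] by blast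
      \<comment> \<open>The inclusion of up-sets is strict because \<open>m\<close> lies in its own
        up-set but, by antisymmetry, not in that of \<open>m'\<close>.\<close>
      moreover have "m \<preceq> m" "\<not> m' \<preceq> m"
        using above[OF m'] reflp_onD[OF le_refl less.prems]
          antisymp_onD[OF le_antisym less.prems m'_mon] by auto
      ultimately have "{l \<in> monomials. m' \<preceq> l} \<subset> {l \<in> monomials. m \<preceq> l}"
        using less.prems by blast
      then show "card {l \<in> monomials. m' \<preceq> l} < card {l \<in> monomials. m \<preceq> l}"
        by (rule psubset_card_mono[OF le_finite[OF less.prems]])
    qed
    then have "reducible p"
      by (subst poly_mapping_eq_sum_single[of p]) (intro reducible_sum; simp)
    then show ?thesis by (rule reducible_congruent[OF p(1)])
  qed
qed

text \<open>For the harder inclusion, a kernel element \<open>f\<close> is congruent to a standard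
  combination \<open>g\<close>. The relation ideal evaluates to zero, so \<open>g\<close> does too,
  and independence forces \<open>g = 0\<close>.\<close>

lemma kernel_eq_relation_ideal:
  "{f \<in> carrier (sym_algebra letters). eval_poly scale f = 0} = relation_ideal"
proof
  show kernel: "relation_ideal \<subseteq> {f \<in> carrier (sym_algebra letters). eval_poly scale f = 0}"
    by (rule ring.genideal_minimal[OF cring.axioms(1)[OF cring_sym_algebra] ideal_kernel
          minimal_relations_kernel])
  show "{f \<in> carrier (sym_algebra letters). eval_poly scale f = 0} \<subseteq> relation_ideal"
  proof
    fix f assume f: "f \<in> {f \<in> carrier (sym_algebra letters). eval_poly scale f = 0}"
    then have "reducible (Poly_Mapping.single m c)" if "m \<in> Poly_Mapping.keys f" for m c
      using that by (intro reducible_single) (auto simp: monomials_def)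
    then have "reducible f"
      by (subst poly_mapping_eq_sum_single[of f]) (intro reducible_sum; simp)
    then obtain g where g: "Poly_Mapping.keys g \<subseteq> standard_monomials" "f - g \<in> relation_ideal"
      unfolding reducible_def by blast
    have "eval_poly scale (f - g) = 0" using g(2) kernel by blast
    then have "g = 0" using standard_combination_zero[OF g(1)] f by (simp add: eval_poly_diff)
    then show "f \<in> relation_ideal" using g(2) by simp
  qed
qed

end

theorem theorem2p1:
  fixes scale :: "'k::field \<Rightarrow> 'a::comm_ring_1 \<Rightarrow> 'a"
    and n :: nat
    and \<A> :: "nat \<Rightarrow> 'a set"
    and arrow :: "'a \<Rightarrow> 'a \<Rightarrow> bool"
    and \<phi> :: "nat \<Rightarrow> nat \<Rightarrow> 'a list \<Rightarrow> 'a list"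
    and leq :: "'a multiset \<Rightarrow> 'a multiset \<Rightarrow> bool"
  assumes "straightening_monomial_theory scale n \<A> arrow \<phi> leq"
  shows "{f \<in> carrier (sym_algebra (swap_data.letters n \<A>)). eval_poly scale f = 0} =
    genideal (sym_algebra (swap_data.letters n \<A>))
      {Poly_Mapping.single m' 1 - p | m' p.
         m' \<in> swap_data.minimally_nonstandard_monomials n \<A> arrow \<phi> \<and>
         straightening_relation scale n \<A> arrow \<phi> leq m' p}"
  using straightening_monomial_theory.kernel_eq_relation_ideal[OF assms]
  unfolding straightening_monomial_theory.minimal_relations_def[OF assms] .

end
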